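(* Let $\partial$ be the standard flat connection on $\mathbb{R}^2$ equipped with the symplectic form $\Omega=dx\wedge dy$. For $f\in C^\infty(\mathbb{R}^2)$ define the symplectic connection $\nabla=\partial+\Pi$ where $\Pi_{ijk}=df_idf_jdf_k$. Then $$\rho(\nabla)=12\,\mathcal{M}(f)\,df-2\,d\,\mathcal{U}(f),\qquad \mathcal{K}(\nabla)=6\{f,\mathcal{M}(f)\}.$$ If $\mathcal{M}(f)$ Poisson commutes with $f$, then $\mathcal{K}(\nabla)=0$, but $\nabla$ is not projectively flat whenever $d\,\mathcal{U}(f)-6\mathcal{M}(f)df$ is somewhere nonzero. In particular, if the graph of $f$ is an improper affine sphere, then $\mathcal{K}(\nabla)=0$. There exist improper affine spheres (graphs of functions $f$) for which the resulting $\nabla$ is not projectively flat.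
   Context: Abstract index notation is used. Indices are raised and lowered by $X_i=X^p\Omega_{pi}$, $X^i=\Omega^{ip}X_p$, where $\Omega^{ip}\Omega_{pj}=-\delta_j{}^i$. $\nabla=\partial+\Pi$ means the connection whose difference tensor with $\partial$ is $\Pi_{ij}{}^k=\Omega^{kp}\Pi_{ijp}$; it is symplectic, i.e. torsion-free with $\nabla\Omega=0$. $\mathcal{M}(f)=\det(\partial_idf^j)=f_{xx}f_{yy}-f_{xy}^2$ is the Hessian determinant, and $\mathcal{U}(f)=df_idf_j\partial^idf^j=f_x^2f_{yy}-2f_xf_yf_{xy}+f_y^2f_{xx}$. The Poisson bracket is $\{u,v\}=-du^pdv_p$, so $\{u,v\}\,\Omega=du\wedge dv$. The graph of $f$ is an improper affine sphere if and only if $\mathcal{M}(f)$ is a nonzero constant. Curvature: $\nabla_i\nabla_jX^k-\nabla_j\nabla_iX^k=R_{ijp}{}^kX^p$, $R_{ij}=R_{pij}{}^p$, $R_{ijkl}=R_{ijk}{}^p\Omega_{pl}$. The curvature one-form is $\rho(\nabla)_i=2\nabla^pR_{ip}$ and $\mathcal{K}(\nabla)=\nabla^i\nabla^jR_{ij}-\tfrac12R^{ij}R_{ij}+\tfrac14R^{ijkl}R_{ijkl}$ (in dimension $2$ this equals $\tfrac12\nabla^i\rho_i$). A symplectic connection on a surface is projectively flat if its projective Cotton tensor $C_{ijk}=-2\nabla_{[i}R_{j]k}$ vanishes; since $2C_{ijk}=\rho_k\Omega_{ij}$, this is equivalent to $\rho=0$. *)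

theory Defs
  imports "HOL-Analysis.Analysis"
begin

text \<open>
  Tensor fields on the plane are given by their components in the standard coordinates
  \<open>x = p $ 1\<close>, \<open>y = p $ 2\<close>; indices have type \<open>2\<close>, and lower indices come before upper ones
  in the argument lists.
\<close>

definition pd :: "2 \<Rightarrow> (real^2 \<Rightarrow> 'a::real_normed_vector) \<Rightarrow> real^2 \<Rightarrow> 'a" where
  "pd i f p = frechet_derivative f (at p) (axis i 1)"

fun Ck :: "nat \<Rightarrow> (real^2 \<Rightarrow> 'a::real_normed_vector) \<Rightarrow> bool" where
  "Ck 0 f \<longleftrightarrow> continuous_on UNIV f"
| "Ck (Suc k) f \<longleftrightarrow> (\<forall>p. f differentiable (at p)) \<and> (\<forall>i. Ck k (pd i f))"

definition smooth :: "(real^2 \<Rightarrow> 'a::real_normed_vector) \<Rightarrow> bool" where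
  "smooth f \<longleftrightarrow> (\<forall>k. Ck k f)"

definition ext_d :: "(real^2 \<Rightarrow> real) \<Rightarrow> 2 \<Rightarrow> real^2 \<Rightarrow> real" where
  "ext_d f i = pd i f"


section \<open>The symplectic form\<close>

definition Omega :: "2 \<Rightarrow> 2 \<Rightarrow> real" where
  "Omega i j = (let dx = (\<lambda>i::2. of_bool (i = 1)); dy = (\<lambda>i::2. of_bool (i = 2))
                in dx i * dy j - dx j * dy i)"

text \<open>
  With the convention \<open>\<Omega>\<^sup>i\<^sup>p \<Omega>\<^sub>p\<^sub>j = - \<delta>\<^sub>j\<^sup>i\<close> (lemma \<open>OmegaU_Omega\<close> below) the bivector has the same
  components as the form.
\<close>

definition OmegaU :: "2 \<Rightarrow> 2 \<Rightarrow> real" where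
  "OmegaU i j = Omega i j"

lemma OmegaU_Omega: "(\<Sum>p\<in>UNIV. OmegaU i p * Omega p j) = - of_bool (i = j)"
  using exhaust_2[of i] exhaust_2[of j] by (auto simp: OmegaU_def Omega_def sum_2)

definition raise :: "(2 \<Rightarrow> real^2 \<Rightarrow> real) \<Rightarrow> 2 \<Rightarrow> real^2 \<Rightarrow> real" where
  "raise \<alpha> i p = (\<Sum>q\<in>UNIV. OmegaU i q * \<alpha> q p)"

definition pd_up :: "2 \<Rightarrow> (real^2 \<Rightarrow> real) \<Rightarrow> real^2 \<Rightarrow> real" where
  "pd_up i f p = (\<Sum>q\<in>UNIV. OmegaU i q * pd q f p)"

definition poisson :: "(real^2 \<Rightarrow> real) \<Rightarrow> (real^2 \<Rightarrow> real) \<Rightarrow> real^2 \<Rightarrow> real" where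
  "poisson u v p = - (\<Sum>q\<in>UNIV. raise (ext_d u) q p * ext_d v q p)"

lemma poisson_eq: "poisson u v p = pd 1 u p * pd 2 v p - pd 2 u p * pd 1 v p"
  by (simp add: poisson_def raise_def ext_d_def sum_2 OmegaU_def Omega_def)

definition hess_det :: "(real^2 \<Rightarrow> real) \<Rightarrow> real^2 \<Rightarrow> real" where
  "hess_det f p = det (\<chi> i j. pd i (raise (ext_d f) j) p)"

definition U_op :: "(real^2 \<Rightarrow> real) \<Rightarrow> real^2 \<Rightarrow> real" where
  "U_op f p = (\<Sum>i\<in>UNIV. \<Sum>j\<in>UNIV.
     ext_d f i p * ext_d f j p * pd_up i (raise (ext_d f) j) p)"


section \<open>Affine connections\<close>

text \<open>
  A connection is given by its coefficients: \<open>\<Gamma> i j k\<close> is \<open>\<Gamma>\<^sub>i\<^sub>j\<^sup>k\<close>, where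
  \<open>\<nabla>\<^sub>i X\<^sup>k = \<partial>\<^sub>i X\<^sup>k + \<Gamma>\<^sub>i\<^sub>j\<^sup>k X\<^sup>j\<close>, that is, its difference tensor with the flat connection
  \<open>\<partial>\<close>. In the covariant derivatives below the new index comes first.
\<close>

type_synonym connection = "2 \<Rightarrow> 2 \<Rightarrow> 2 \<Rightarrow> real^2 \<Rightarrow> real"

definition cov_vec :: "connection \<Rightarrow> (2 \<Rightarrow> real^2 \<Rightarrow> real) \<Rightarrow> 2 \<Rightarrow> 2 \<Rightarrow> real^2 \<Rightarrow> real" where
  "cov_vec \<Gamma> X i k p = pd i (X k) p + (\<Sum>q\<in>UNIV. \<Gamma> i q k p * X q p)"

definition cov_mixed ::
    "connection \<Rightarrow> (2 \<Rightarrow> 2 \<Rightarrow> real^2 \<Rightarrow> real) \<Rightarrow> 2 \<Rightarrow> 2 \<Rightarrow> 2 \<Rightarrow> real^2 \<Rightarrow> real" where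
  "cov_mixed \<Gamma> T i j k p = pd i (T j k) p
     - (\<Sum>q\<in>UNIV. \<Gamma> i j q p * T q k p) + (\<Sum>q\<in>UNIV. \<Gamma> i q k p * T j q p)"

definition cov2 ::
    "connection \<Rightarrow> (2 \<Rightarrow> 2 \<Rightarrow> real^2 \<Rightarrow> real) \<Rightarrow> 2 \<Rightarrow> 2 \<Rightarrow> 2 \<Rightarrow> real^2 \<Rightarrow> real" where
  "cov2 \<Gamma> T a i j p = pd a (T i j) p
     - (\<Sum>q\<in>UNIV. \<Gamma> a i q p * T q j p) - (\<Sum>q\<in>UNIV. \<Gamma> a j q p * T i q p)"

definition cov3 ::
    "connection \<Rightarrow> (2 \<Rightarrow> 2 \<Rightarrow> 2 \<Rightarrow> real^2 \<Rightarrow> real) \<Rightarrow> 2 \<Rightarrow> 2 \<Rightarrow> 2 \<Rightarrow> 2 \<Rightarrow> real^2 \<Rightarrow> real" where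
  "cov3 \<Gamma> T a i j k p = pd a (T i j k) p
     - (\<Sum>q\<in>UNIV. \<Gamma> a i q p * T q j k p) - (\<Sum>q\<in>UNIV. \<Gamma> a j q p * T i q k p)
     - (\<Sum>q\<in>UNIV. \<Gamma> a k q p * T i j q p)"

definition symplectic_connection :: "connection \<Rightarrow> bool" where
  "symplectic_connection \<Gamma> \<longleftrightarrow>
     (\<forall>i j k. smooth (\<Gamma> i j k)) \<and>
     (\<forall>i j k. \<Gamma> i j k = \<Gamma> j i k) \<and>
     (\<forall>a i j p. cov2 \<Gamma> (\<lambda>i j _. Omega i j) a i j p = 0)"

text \<open>
  Curvature components \<open>R\<^sub>i\<^sub>j\<^sub>p\<^sup>k\<close>: the Ricci identity
  \<open>\<nabla>\<^sub>i\<nabla>\<^sub>j X\<^sup>k - \<nabla>\<^sub>j\<nabla>\<^sub>i X\<^sup>k = R\<^sub>i\<^sub>j\<^sub>p\<^sup>k X\<^sup>p\<close> (for torsion-free connections) evaluated on the coordinate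
  vector field \<open>X = \<partial>/\<partial>x\<^sup>p\<close>. The base point is called \<open>z\<close> here.
\<close>

definition curv :: "connection \<Rightarrow> 2 \<Rightarrow> 2 \<Rightarrow> 2 \<Rightarrow> 2 \<Rightarrow> real^2 \<Rightarrow> real" where
  "curv \<Gamma> i j p k z =
     (let X = (\<lambda>l _. of_bool (l = p)) in
      cov_mixed \<Gamma> (cov_vec \<Gamma> X) i j k z - cov_mixed \<Gamma> (cov_vec \<Gamma> X) j i k z)"

definition curv_low :: "connection \<Rightarrow> 2 \<Rightarrow> 2 \<Rightarrow> 2 \<Rightarrow> 2 \<Rightarrow> real^2 \<Rightarrow> real" where
  "curv_low \<Gamma> i j k l z = (\<Sum>p\<in>UNIV. curv \<Gamma> i j k p z * Omega p l)"

definition curv_up :: "connection \<Rightarrow> 2 \<Rightarrow> 2 \<Rightarrow> 2 \<Rightarrow> 2 \<Rightarrow> real^2 \<Rightarrow> real" where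
  "curv_up \<Gamma> i j k l z = (\<Sum>a\<in>UNIV. \<Sum>b\<in>UNIV. \<Sum>c\<in>UNIV. \<Sum>d\<in>UNIV.
     OmegaU i a * OmegaU j b * OmegaU k c * OmegaU l d * curv_low \<Gamma> a b c d z)"

definition ricci :: "connection \<Rightarrow> 2 \<Rightarrow> 2 \<Rightarrow> real^2 \<Rightarrow> real" where
  "ricci \<Gamma> i j z = (\<Sum>p\<in>UNIV. curv \<Gamma> p i j p z)"

definition ricci_up :: "connection \<Rightarrow> 2 \<Rightarrow> 2 \<Rightarrow> real^2 \<Rightarrow> real" where
  "ricci_up \<Gamma> i j z = (\<Sum>a\<in>UNIV. \<Sum>b\<in>UNIV. OmegaU i a * OmegaU j b * ricci \<Gamma> a b z)"

definition rho :: "connection \<Rightarrow> 2 \<Rightarrow> real^2 \<Rightarrow> real" where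
  "rho \<Gamma> i z = 2 * (\<Sum>p\<in>UNIV. \<Sum>q\<in>UNIV. OmegaU p q * cov2 \<Gamma> (ricci \<Gamma>) q i p z)"

definition K_curv :: "connection \<Rightarrow> real^2 \<Rightarrow> real" where
  "K_curv \<Gamma> z =
     (\<Sum>i\<in>UNIV. \<Sum>j\<in>UNIV. \<Sum>p\<in>UNIV. \<Sum>q\<in>UNIV.
        OmegaU i p * OmegaU j q * cov3 \<Gamma> (cov2 \<Gamma> (ricci \<Gamma>)) p q i j z)
     - 1/2 * (\<Sum>i\<in>UNIV. \<Sum>j\<in>UNIV. ricci_up \<Gamma> i j z * ricci \<Gamma> i j z)
     + 1/4 * (\<Sum>i\<in>UNIV. \<Sum>j\<in>UNIV. \<Sum>k\<in>UNIV. \<Sum>l\<in>UNIV.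
        curv_up \<Gamma> i j k l z * curv_low \<Gamma> i j k l z)"

text \<open>The bracket in \<open>C\<^sub>i\<^sub>j\<^sub>k = -2 \<nabla>\<^sub>[\<^sub>i R\<^sub>j\<^sub>]\<^sub>k\<close> is antisymmetrization with the factor \<open>1/2\<close>.\<close>

definition cotton :: "connection \<Rightarrow> 2 \<Rightarrow> 2 \<Rightarrow> 2 \<Rightarrow> real^2 \<Rightarrow> real" where
  "cotton \<Gamma> i j k z = - 2 * ((cov2 \<Gamma> (ricci \<Gamma>) i j k z - cov2 \<Gamma> (ricci \<Gamma>) j i k z) / 2)"

definition projectively_flat :: "connection \<Rightarrow> bool" where
  "projectively_flat \<Gamma> \<longleftrightarrow> (\<forall>i j k z. cotton \<Gamma> i j k z = 0)"

definition conn_of :: "(2 \<Rightarrow> 2 \<Rightarrow> 2 \<Rightarrow> real^2 \<Rightarrow> real) \<Rightarrow> connection" where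
  "conn_of P i j k z = (\<Sum>p\<in>UNIV. OmegaU k p * P i j p z)"

definition cubic_conn :: "(real^2 \<Rightarrow> real) \<Rightarrow> connection" where
  "cubic_conn f = conn_of (\<lambda>i j k z. ext_d f i z * ext_d f j z * ext_d f k z)"


section \<open>Improper affine spheres\<close>

definition tangent_plane :: "(real^2 \<Rightarrow> real^3) \<Rightarrow> real^2 \<Rightarrow> (real^3) set" where
  "tangent_plane F z = span (range (\<lambda>i. pd i F z))"

definition vol_frame :: "(real^2 \<Rightarrow> real^3) \<Rightarrow> (real^2 \<Rightarrow> real^3) \<Rightarrow> real^2 \<Rightarrow> real" where
  "vol_frame F \<xi> z = det (vector [pd 1 F z, pd 2 F z, \<xi> z])"

text \<open>
  \<open>\<xi>\<close> is a (Blaschke) affine normal field of the nondegenerate immersion \<open>F\<close>: it is transverse; with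
  \<open>h\<close> the second fundamental form in the Gauss formula \<open>\<partial>\<^sub>i\<partial>\<^sub>j F \<equiv> h\<^sub>i\<^sub>j \<xi>\<close> modulo tangent vectors,
  \<open>h\<close> is nondegenerate; \<open>\<partial>\<^sub>i \<xi>\<close> is tangential (so the induced volume form is parallel); and the induced
  volume form \<open>vol (\<partial>\<^sub>1 F, \<partial>\<^sub>2 F, \<xi>)\<close> agrees up to sign with the volume form \<open>\<bar>det h\<bar>\<^sup>1\<^sup>/\<^sup>2\<close> of \<open>h\<close>.
  These conditions determine \<open>\<xi>\<close> up to sign.
\<close>

definition affine_normal :: "(real^2 \<Rightarrow> real^3) \<Rightarrow> (real^2 \<Rightarrow> real^3) \<Rightarrow> bool" where
  "affine_normal F \<xi> \<longleftrightarrow> smooth \<xi> \<and>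
     (\<exists>h :: 2 \<Rightarrow> 2 \<Rightarrow> real^2 \<Rightarrow> real. \<forall>z.
        vol_frame F \<xi> z \<noteq> 0 \<and>
        (\<forall>i j. pd i (pd j F) z - h i j z *\<^sub>R \<xi> z \<in> tangent_plane F z) \<and>
        det (\<chi> i j. h i j z) \<noteq> 0 \<and>
        (\<forall>i. pd i \<xi> z \<in> tangent_plane F z) \<and>
        \<bar>det (\<chi> i j. h i j z)\<bar> = (vol_frame F \<xi> z)\<^sup>2)"

definition graph_imm :: "(real^2 \<Rightarrow> real) \<Rightarrow> real^2 \<Rightarrow> real^3" where
  "graph_imm f z = vector [z $ 1, z $ 2, f z]"

text \<open>
  An improper affine sphere has parallel affine normal lines. For a graph their common direction is
  taken to be that of the dependent coordinate. This is the convention under which the graph of \<open>f\<close>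
  is an improper affine sphere exactly when the Hessian determinant is a nonzero constant (lemma
  \<open>improper_affine_sphere_graph_iff\<close> below); a piece of a tilted elliptic paraboloid has parallel
  affine normals but, as a graph, nonconstant Hessian determinant.
\<close>

definition improper_affine_sphere_graph :: "(real^2 \<Rightarrow> real) \<Rightarrow> bool" where
  "improper_affine_sphere_graph f \<longleftrightarrow>
     (\<exists>\<xi>. affine_normal (graph_imm f) \<xi> \<and> (\<forall>z. \<xi> z \<in> span {axis 3 1}))"

lemma pd_eqI: "(f has_derivative f') (at p) \<Longrightarrow> pd i f p = f' (axis i 1)"
  by (metis pd_def frechet_derivative_at)

lemma pd_const [simp]: "pd i (\<lambda>_. c) = (\<lambda>_. 0)"
  by (rule ext, rule pd_eqI[where f' = "\<lambda>_. 0"]) simp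

lemma Ck_const: "Ck k (\<lambda>_. c)"
  by (induction k arbitrary: c) auto

lemma smooth_const: "smooth (\<lambda>_. c)"
  by (simp add: smooth_def Ck_const)

lemma smooth_differentiable: "smooth f \<Longrightarrow> f differentiable (at p)"
  unfolding smooth_def by (metis Ck.simps(2))

lemma smooth_continuous: "smooth f \<Longrightarrow> continuous_on UNIV f"
  unfolding smooth_def by (metis Ck.simps(1))

lemma smooth_pd: "smooth f \<Longrightarrow> smooth (pd i f)"
  unfolding smooth_def by (metis Ck.simps(2))

lemma pd_has_derivative: "f differentiable (at p) \<Longrightarrow> (f has_derivative frechet_derivative f (at p)) (at p)"
  by (simp add: frechet_derivative_works)

lemma has_derivative_vector_3:
  assumes "(a has_derivative a') (at p)" "(b has_derivative b') (at p)" "(c has_derivative c') (at p)"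
  shows "((\<lambda>z. vector [a z, b z, c z] :: real^3) has_derivative
     (\<lambda>v. vector [a' v, b' v, c' v])) (at p)"
proof -
  have *: "vector [x, y, w] = x *\<^sub>R axis 1 1 + y *\<^sub>R axis 2 1 + w *\<^sub>R (axis 3 1 :: real^3)" for x y w :: real
    by (simp add: vec_eq_iff forall_3 axis_def)
  show ?thesis unfolding * using assms by (auto intro!: derivative_eq_intros)
qed

lemma pd_vector_3:
  fixes a b c :: "real^2 \<Rightarrow> real"
  assumes "a differentiable (at p)" "b differentiable (at p)" "c differentiable (at p)"
  shows "pd i (\<lambda>z. vector [a z, b z, c z] :: real^3) p = vector [pd i a p, pd i b p, pd i c p]"
  using pd_eqI[OF has_derivative_vector_3[OF assms[THEN pd_has_derivative]], of i] by (simp add: pd_def)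

lemma pd_nth: "pd i (\<lambda>z. z $ k) p = of_bool (i = k)"
  by (subst pd_eqI[where f' = "\<lambda>v. v $ k"])
     (auto intro!: bounded_linear_imp_has_derivative bounded_linear_vec_nth simp: axis_def)

lemma hess_det_eq:
  assumes "smooth f"
  shows "hess_det f p = pd 1 (pd 1 f) p * pd 2 (pd 2 f) p - pd 1 (pd 2 f) p * pd 2 (pd 1 f) p"
proof -
  have r1: "raise (ext_d f) 1 = pd 2 f" and r2: "raise (ext_d f) 2 = (\<lambda>p. - pd 1 f p)"
    by (auto simp: raise_def ext_d_def sum_2 OmegaU_def Omega_def fun_eq_iff)
  have "pd i (\<lambda>p. - pd 1 f p) p = - pd i (pd 1 f) p" for i
    using pd_eqI[OF has_derivative_minus[OF pd_has_derivative[OF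
      smooth_differentiable[OF smooth_pd[OF assms]]]], of i 1 p] by (simp add: pd_def)
  then show ?thesis by (simp add: hess_det_def det_2 r1 r2)
qed

lemma pd_graph_imm:
  assumes "smooth f"
  shows "pd i (graph_imm f) z = vector [of_bool (i = 1), of_bool (i = 2), pd i f z]"
    and "pd i (pd j (graph_imm f)) z = vector [0, 0, pd i (pd j f) z]"
proof -
  have d: "(\<lambda>z::real^2. z $ k) differentiable (at p)" for k p
    by (intro bounded_linear_imp_differentiable bounded_linear_vec_nth)
  have *: "pd i (graph_imm f) z = vector [of_bool (i = 1), of_bool (i = 2), pd i f z]" for i z
    unfolding graph_imm_def[abs_def]
    by (simp add: pd_vector_3[OF d d smooth_differentiable[OF assms]] pd_nth)
  show "pd i (graph_imm f) z = vector [of_bool (i = 1), of_bool (i = 2), pd i f z]" by (rule *)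
  have "pd j (graph_imm f) = (\<lambda>z. vector [of_bool (j = 1), of_bool (j = 2), pd j f z])"
    by (rule ext) (rule *)
  then show "pd i (pd j (graph_imm f)) z = vector [0, 0, pd i (pd j f) z]"
    by (simp add: pd_vector_3 smooth_differentiable[OF smooth_pd[OF assms]])
qed

lemma vertical_tangent_iff:
  assumes "smooth f"
  shows "vector [0, 0, t] \<in> tangent_plane (graph_imm f) z \<longleftrightarrow> t = 0"
proof
  have "vector [0, 0, 0] = (0 :: real^3)" by (simp add: vec_eq_iff forall_3)
  then show "t = 0 \<Longrightarrow> vector [0, 0, t] \<in> tangent_plane (graph_imm f) z"
    by (simp add: tangent_plane_def span_zero)
next
  let ?n = "vector [- pd 1 f z, - pd 2 f z, 1] :: real^3"
  assume "vector [0, 0, t] \<in> tangent_plane (graph_imm f) z"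
  then have "orthogonal ?n (vector [0, 0, t])"
    unfolding tangent_plane_def
  proof (rule orthogonal_to_span)
    fix y assume "y \<in> range (\<lambda>i. pd i (graph_imm f) z)"
    then obtain i where "y = pd i (graph_imm f) z" by blast
    then show "orthogonal ?n y"
      using exhaust_2[of i]
      by (auto simp: pd_graph_imm[OF assms] orthogonal_def inner_vec_def sum_3)
  qed
  then show "t = 0" by (simp add: orthogonal_def inner_vec_def sum_3)
qed

lemma affine_normal_vertical_iff:
  assumes f: "smooth f" and \<phi>: "smooth \<phi>"
    and s: "smooth (\<lambda>z. vector [0, 0, \<phi> z] :: real^3)"
  shows "affine_normal (graph_imm f) (\<lambda>z. vector [0, 0, \<phi> z]) \<longleftrightarrow>
     (\<forall>z. \<phi> z \<noteq> 0 \<and> (\<forall>i. pd i \<phi> z = 0) \<and> \<bar>hess_det f z\<bar> = (\<phi> z)^4)"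
    (is "?L \<longleftrightarrow> ?R")
proof -
  let ?F = "graph_imm f" and ?\<xi> = "\<lambda>z. vector [0, 0, \<phi> z] :: real^3"
  have vol: "vol_frame ?F ?\<xi> z = \<phi> z" for z
    by (simp add: vol_frame_def det_3 pd_graph_imm[OF f])
  have d\<xi>: "pd i ?\<xi> z \<in> tangent_plane ?F z \<longleftrightarrow> pd i \<phi> z = 0" for i z
    by (simp add: pd_vector_3 smooth_differentiable[OF \<phi>] vertical_tangent_iff[OF f])
  have gauss: "pd i (pd j ?F) z - c *\<^sub>R ?\<xi> z \<in> tangent_plane ?F z \<longleftrightarrow> pd i (pd j f) z = c * \<phi> z" for i j c z
  proof -
    have "pd i (pd j ?F) z - c *\<^sub>R ?\<xi> z = vector [0, 0, pd i (pd j f) z - c * \<phi> z]"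
      by (simp add: pd_graph_imm[OF f] vec_eq_iff forall_3)
    then show ?thesis by (simp add: vertical_tangent_iff[OF f])
  qed
  show ?thesis
  proof
    assume ?L
    then obtain h where h: "\<And>z. \<phi> z \<noteq> 0" "\<And>i j z. pd i (pd j f) z = h i j z * \<phi> z"
      "\<And>i z. pd i \<phi> z = 0" "\<And>z. \<bar>det (\<chi> i j. h i j z)\<bar> = (\<phi> z)\<^sup>2"
      unfolding affine_normal_def vol d\<xi> gauss by blast
    have "hess_det f z = det (\<chi> i j. h i j z) * (\<phi> z)\<^sup>2" for z
      by (simp add: hess_det_eq[OF f] h(2) det_2 power2_eq_square algebra_simps)
    then have "\<bar>hess_det f z\<bar> = (\<phi> z)\<^sup>2 * (\<phi> z)\<^sup>2" for z
      by (simp only: abs_mult h(4) abs_power2)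
    then have "\<bar>hess_det f z\<bar> = (\<phi> z)^4" for z
      by (simp flip: power_add)
    with h show ?R by blast
  next
    assume R: ?R
    define h where "h i j z = pd i (pd j f) z / \<phi> z" for i j z
    have *: "det (\<chi> i j. h i j z) = hess_det f z / (\<phi> z)\<^sup>2" for z
      by (simp add: hess_det_eq[OF f] h_def det_2 power2_eq_square diff_divide_distrib)
    have **: "\<bar>det (\<chi> i j. h i j z)\<bar> = (\<phi> z)\<^sup>2" for z
      using R by (simp add: * power2_eq_square power4_eq_xxxx)
    have "det (\<chi> i j. h i j z) \<noteq> 0" for z
      using **[of z] R by auto
    moreover have "pd i (pd j f) z = h i j z * \<phi> z" for i j z
      using R by (simp add: h_def)
    ultimately show ?L
      unfolding affine_normal_def vol d\<xi> gauss using R ** s by blast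
  qed
qed

lemma smooth_bounded_linear:
  assumes l: "bounded_linear l" and f: "smooth f"
  shows "smooth (\<lambda>z. l (f z))"
proof -
  have "Ck k f \<Longrightarrow> Ck k (\<lambda>z. l (f z))" for k
  proof (induction k arbitrary: f)
    case 0
    then show ?case using bounded_linear.continuous_on[OF l] by auto
  next
    case (Suc k)
    have d: "((\<lambda>z. l (f z)) has_derivative (\<lambda>v. l (frechet_derivative f (at p) v))) (at p)" for p
      using Suc.prems by (auto intro!: bounded_linear.has_derivative[OF l] pd_has_derivative)
    have "pd i (\<lambda>z. l (f z)) = (\<lambda>z. l (pd i f z))" for i
      by (rule ext, subst pd_eqI[OF d]) (simp add: pd_def)
    then show ?case using Suc d by (auto simp: differentiable_def)
  qed
  with f show ?thesis by (simp add: smooth_def)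
qed

lemma improper_affine_sphere_graph_iff:
  assumes f: "smooth f"
  shows "improper_affine_sphere_graph f \<longleftrightarrow> (\<exists>c. c \<noteq> 0 \<and> (\<forall>z. hess_det f z = c))"
proof
  assume "improper_affine_sphere_graph f"
  then obtain \<xi> where \<xi>: "affine_normal (graph_imm f) \<xi>" "\<And>z. \<xi> z \<in> span {axis 3 1}"
    unfolding improper_affine_sphere_graph_def by blast
  define \<phi> where "\<phi> z = \<xi> z $ 3" for z
  have \<xi>_eq: "\<xi> = (\<lambda>z. vector [0, 0, \<phi> z])"
  proof
    fix z
    obtain k where "\<xi> z = k *\<^sub>R axis 3 1" using \<xi>(2)[of z] by (auto simp: span_singleton)
    then show "\<xi> z = vector [0, 0, \<phi> z]" by (simp add: \<phi>_def vec_eq_iff forall_3 axis_def)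
  qed
  have s: "smooth \<xi>" using \<xi>(1) by (simp add: affine_normal_def)
  have s\<phi>: "smooth \<phi>" unfolding \<phi>_def[abs_def]
    by (rule smooth_bounded_linear[OF bounded_linear_vec_nth s])
  have R: "\<phi> z \<noteq> 0" "pd i \<phi> z = 0" "\<bar>hess_det f z\<bar> = (\<phi> z)^4" for i z
    using \<xi>(1) s affine_normal_vertical_iff[OF f s\<phi>] unfolding \<xi>_eq by blast+
  have "(\<phi> has_derivative (\<lambda>_. 0)) (at z)" for z
  proof -
    note D = pd_has_derivative[OF smooth_differentiable[OF s\<phi>], of z]
    have lin: "linear (frechet_derivative \<phi> (at z))" using D by (rule has_derivative_linear)
    have "frechet_derivative \<phi> (at z) = (\<lambda>_. 0)"
      by (rule linear_eq_stdbasis[OF lin linear_zero])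
         (use R(2) in \<open>auto simp: Basis_vec_def pd_def\<close>)
    with D show ?thesis by simp
  qed
  then have "\<exists>k. \<forall>z\<in>UNIV. \<phi> z = k"
    by (intro has_derivative_zero_constant convex_UNIV)
  then obtain k where k: "\<And>z. \<phi> z = k"
    by blast
  have sq: "\<bar>hess_det f z\<bar> = k^4" for z using R(3) k by simp
  have k0: "k^4 > 0" using R(1) k by simp
  have c: "continuous_on UNIV (hess_det f)"
    unfolding hess_det_eq[OF f, abs_def]
    by (intro continuous_intros smooth_continuous smooth_pd f)
  have "connected (range (hess_det f))" by (rule connected_continuous_image[OF c connected_UNIV])
  then have iv: "\<And>a b x. a \<in> range (hess_det f) \<Longrightarrow> b \<in> range (hess_det f) \<Longrightarrow> a \<le> x \<Longrightarrow> x \<le> b \<Longrightarrow> x \<in> range (hess_det f)"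
    unfolding connected_iff_interval by blast
  have "hess_det f z = hess_det f 0" for z
  proof (rule ccontr)
    assume "hess_det f z \<noteq> hess_det f 0"
    then have "0 \<in> range (hess_det f)"
      using sq[of z] sq[of 0] k0 iv[of "hess_det f z" "hess_det f 0" 0] iv[of "hess_det f 0" "hess_det f z" 0]
      by (auto simp: abs_if split: if_splits)
    then obtain w where "hess_det f w = 0" by (metis rangeE)
    then show False using sq[of w] k0 by simp
  qed
  moreover have "hess_det f 0 \<noteq> 0" using sq[of 0] k0 by auto
  ultimately show "\<exists>c. c \<noteq> 0 \<and> (\<forall>z. hess_det f z = c)" by blast
next
  assume "\<exists>c. c \<noteq> 0 \<and> (\<forall>z. hess_det f z = c)"
  then obtain c where c: "c \<noteq> 0" "\<And>z. hess_det f z = c" by blast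
  define k where "k = root 4 \<bar>c\<bar>"
  have k: "k^4 = \<bar>c\<bar>" by (simp add: k_def)
  then have "k \<noteq> 0" using c by auto
  then have "affine_normal (graph_imm f) (\<lambda>_. vector [0, 0, k])"
    using affine_normal_vertical_iff[OF f smooth_const[of k] smooth_const] k c by simp
  moreover have "vector [0, 0, k] \<in> span {axis 3 1 :: real^3}"
    by (auto simp: span_singleton vec_eq_iff forall_3 axis_def intro!: exI[of _ k])
  ultimately show "improper_affine_sphere_graph f"
    unfolding improper_affine_sphere_graph_def by blast
qed

end

theory Submission
  imports Defs
begin

text \<open>
  For \<open>\<Pi>\<^sub>i\<^sub>j\<^sub>k = df\<^sub>i df\<^sub>j df\<^sub>k\<close> the curvature is linear in \<open>\<Pi>\<close> because \<open>df\<^sup>p df\<^sub>p = 0\<close>, so the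
  Ricci tensor is \<open>df\<^sup>p \<partial>\<^sub>p (df\<^sub>i df\<^sub>j)\<close>, and \<open>\<rho>\<close> comes from one more differentiation. The two
  quadratic terms of \<open>\<K>\<close> cancel in dimension \<open>2\<close>, and its first term is \<open>\<nabla>\<^sup>i \<rho>\<^sub>i / 2\<close>, which for a
  symplectic connection only involves the exterior derivative of \<open>\<rho>\<close>: the exact part
  \<open>-2 d\<U>(f)\<close> disappears and \<open>12 \<M>(f) df\<close> gives the Poisson bracket. A nonzero \<open>\<rho>\<close> excludes projective
  flatness.
\<close>

section \<open>Calculus of smooth functions\<close>

lemma Ck_Suc_imp: "Ck (Suc k) f \<Longrightarrow> Ck k f"
proof (induction k arbitrary: f)
  case 0
  then show ?case by (auto intro: differentiable_imp_continuous_on simp: differentiable_on_def differentiable_at_withinI)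
next
  case (Suc k)
  then show ?case by auto
qed

lemma pd_add_at:
  fixes f g :: "real^2 \<Rightarrow> real"
  assumes "f differentiable (at p)" "g differentiable (at p)"
  shows "pd i (\<lambda>z. f z + g z) p = pd i f p + pd i g p"
  using pd_eqI[OF has_derivative_add[OF assms[THEN pd_has_derivative]], of i] by (simp add: pd_def)

lemma pd_mult_at:
  fixes f g :: "real^2 \<Rightarrow> real"
  assumes "f differentiable (at p)" "g differentiable (at p)"
  shows "pd i (\<lambda>z. f z * g z) p = pd i f p * g p + f p * pd i g p"
  using pd_eqI[OF has_derivative_mult[OF assms[THEN pd_has_derivative]], of i] by (simp add: pd_def)

lemma Ck_add:
  fixes f g :: "real^2 \<Rightarrow> real"
  shows "Ck k f \<Longrightarrow> Ck k g \<Longrightarrow> Ck k (\<lambda>z. f z + g z)"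
proof (induction k arbitrary: f g)
  case 0
  then show ?case by (auto intro: continuous_on_add)
next
  case (Suc k)
  then have "pd i (\<lambda>z. f z + g z) = (\<lambda>z. pd i f z + pd i g z)" for i
    by (simp add: pd_add_at fun_eq_iff)
  with Suc show ?case by auto
qed

lemma Ck_mult:
  fixes f g :: "real^2 \<Rightarrow> real"
  shows "Ck k f \<Longrightarrow> Ck k g \<Longrightarrow> Ck k (\<lambda>z. f z * g z)"
proof (induction k arbitrary: f g)
  case 0
  then show ?case by (auto intro: continuous_on_mult)
next
  case (Suc k)
  then have "pd i (\<lambda>z. f z * g z) = (\<lambda>z. pd i f z * g z + f z * pd i g z)" for i
    by (simp add: pd_mult_at fun_eq_iff)
  \<comment> \<open>The product rule leaves one factor undifferentiated, so the induction also needs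
    the factors themselves in the lower class.\<close>
  moreover have "Ck k f" "Ck k g" using Suc.prems by (auto intro: Ck_Suc_imp simp del: Ck.simps)
  ultimately show ?case using Suc by (auto intro!: Ck_add)
qed

context
  fixes f g :: "real^2 \<Rightarrow> real"
  assumes f: "smooth f" and g: "smooth g"
begin

lemma smooth_add: "smooth (\<lambda>z. f z + g z)"
  using f g by (simp add: smooth_def Ck_add)

lemma smooth_mult: "smooth (\<lambda>z. f z * g z)"
  using f g by (simp add: smooth_def Ck_mult)

lemma pd_add: "pd i (\<lambda>z. f z + g z) = (\<lambda>z. pd i f z + pd i g z)"
  using f g by (simp add: fun_eq_iff pd_add_at smooth_differentiable)

lemma pd_mult: "pd i (\<lambda>z. f z * g z) = (\<lambda>z. pd i f z * g z + f z * pd i g z)"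
  using f g by (simp add: fun_eq_iff pd_mult_at smooth_differentiable)

end

lemma smooth_uminus: "smooth f \<Longrightarrow> smooth (\<lambda>z. - f z :: real)"
  using smooth_mult[OF smooth_const[of "-1"]] by simp

lemma pd_uminus: "smooth f \<Longrightarrow> pd i (\<lambda>z. - f z :: real) = (\<lambda>z. - pd i f z)"
  using pd_mult[OF smooth_const[of "-1"]] by simp

lemma smooth_diff: "smooth f \<Longrightarrow> smooth g \<Longrightarrow> smooth (\<lambda>z. f z - g z :: real)"
  using smooth_add[OF _ smooth_uminus] by simp

lemma pd_diff: "smooth f \<Longrightarrow> smooth g \<Longrightarrow> pd i (\<lambda>z. f z - g z :: real) = (\<lambda>z. pd i f z - pd i g z)"
  using pd_add[OF _ smooth_uminus] by (simp add: pd_uminus)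

lemmas smooth_rules = smooth_const smooth_pd smooth_add smooth_mult smooth_uminus smooth_diff
lemmas pd_rules = pd_add pd_mult pd_uminus pd_diff

section \<open>Symmetry of second partial derivatives\<close>

lemma pd_line_derivative:
  fixes f :: "real^2 \<Rightarrow> real"
  assumes "smooth f"
  shows "((\<lambda>t. f (q + t *\<^sub>R axis i 1)) has_real_derivative pd i f (q + t *\<^sub>R axis i 1)) (at t)"
proof -
  let ?D = "frechet_derivative f (at (q + t *\<^sub>R axis i 1))"
  have D: "(f has_derivative ?D) (at (q + t *\<^sub>R axis i 1))"
    by (rule pd_has_derivative[OF smooth_differentiable[OF assms]])
  have "((\<lambda>t. q + t *\<^sub>R axis i 1) has_derivative (\<lambda>h. h *\<^sub>R axis i 1)) (at t)"
    by (auto intro!: derivative_eq_intros)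
  from has_derivative_compose[OF this D]
  have "((\<lambda>t. f (q + t *\<^sub>R axis i 1)) has_derivative (\<lambda>h. ?D (h *\<^sub>R axis i 1))) (at t)" .
  moreover have "(\<lambda>h. ?D (h *\<^sub>R axis i 1)) = (*) (pd i f (q + t *\<^sub>R axis i 1))"
    using linear_cmul[OF has_derivative_linear[OF D]] by (auto simp: pd_def fun_eq_iff)
  ultimately show ?thesis by (simp add: has_field_derivative_def)
qed

text \<open>Two mean value steps: first along axis \<open>i\<close> for the increment of
  \<open>f\<close> in direction \<open>j\<close>, then along axis \<open>j\<close> for
  \<open>pd i f\<close>. The second difference is symmetric in \<open>i\<close> and
  \<open>j\<close>, but the mixed derivative that it produces is not visibly so.\<close>

lemma second_difference_mvt:
  fixes f :: "real^2 \<Rightarrow> real"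
  assumes f: "smooth f" and h: "h > 0"
  shows "\<exists>s r. 0 < s \<and> s < h \<and> 0 < r \<and> r < h \<and>
    f (p + h *\<^sub>R axis i 1 + h *\<^sub>R axis j 1) - f (p + h *\<^sub>R axis i 1) - f (p + h *\<^sub>R axis j 1) + f p
      = h * h * pd j (pd i f) (p + s *\<^sub>R axis i 1 + r *\<^sub>R axis j 1)"
proof -
  let ?g = "\<lambda>t. f ((p + h *\<^sub>R axis j 1) + t *\<^sub>R axis i 1) - f (p + t *\<^sub>R axis i 1)"
  have "\<exists>s. 0 < s \<and> s < h \<and> ?g h - ?g 0
      = (h - 0) * (pd i f ((p + h *\<^sub>R axis j 1) + s *\<^sub>R axis i 1) - pd i f (p + s *\<^sub>R axis i 1))"
    using h by (intro MVT2 DERIV_diff pd_line_derivative f)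
  then obtain s where s: "0 < s" "s < h" "?g h - ?g 0
      = h * (pd i f ((p + h *\<^sub>R axis j 1) + s *\<^sub>R axis i 1) - pd i f (p + s *\<^sub>R axis i 1))"
    by auto
  let ?k = "\<lambda>t. pd i f ((p + s *\<^sub>R axis i 1) + t *\<^sub>R axis j 1)"
  have "\<exists>r. 0 < r \<and> r < h \<and> ?k h - ?k 0 = (h - 0) * pd j (pd i f) ((p + s *\<^sub>R axis i 1) + r *\<^sub>R axis j 1)"
    using h by (intro MVT2 pd_line_derivative smooth_pd f)
  then obtain r where r: "0 < r" "r < h"
      "?k h - ?k 0 = h * pd j (pd i f) ((p + s *\<^sub>R axis i 1) + r *\<^sub>R axis j 1)"
    by auto
  have "?g h - ?g 0 = h * (?k h - ?k 0)"
    using s(3) by (simp add: ac_simps)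
  with r(3) have "?g h - ?g 0 = h * h * pd j (pd i f) ((p + s *\<^sub>R axis i 1) + r *\<^sub>R axis j 1)"
    by simp
  with s(1,2) r(1,2) show ?thesis
    by (intro exI[of _ s] exI[of _ r]) (simp add: ac_simps)
qed

text \<open>For each step size \<open>1 / Suc n\<close> the same second difference is evaluated in
  both orders, which equates the two mixed derivatives at two nearby points. As the points tend to
  \<open>p\<close>, continuity of both derivatives gives equality there.\<close>

lemma pd_commute:
  fixes f :: "real^2 \<Rightarrow> real"
  assumes f: "smooth f"
  shows "pd i (pd j f) = pd j (pd i f)"
proof
  fix p
  have lim: "(\<lambda>n. pd j (pd i f) (p + s n *\<^sub>R axis i 1 + r n *\<^sub>R axis j 1)) \<longlonglongrightarrow> pd j (pd i f) p"
    if "\<And>n. 0 < s n \<and> s n < 1 / Suc n \<and> 0 < r n \<and> r n < 1 / Suc n" for s r :: "nat \<Rightarrow> real" and i j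
  proof -
    have "s \<longlonglongrightarrow> 0" "r \<longlonglongrightarrow> 0"
      using that
      by (auto intro!: tendsto_sandwich[OF _ _ tendsto_const LIMSEQ_Suc[OF lim_1_over_n]] always_eventually less_imp_le
          simp del: of_nat_Suc)
    then have "(\<lambda>n. p + s n *\<^sub>R axis i 1 + r n *\<^sub>R axis j 1) \<longlonglongrightarrow> p + 0 *\<^sub>R axis i 1 + 0 *\<^sub>R axis j 1"
      by (intro tendsto_intros)
    then show ?thesis
      using smooth_continuous[OF smooth_pd[OF smooth_pd[OF f]], of j i]
      by (intro isCont_tendsto_compose[of p "pd j (pd i f)"])
        (auto simp: continuous_on_eq_continuous_at)
  qed
  have "\<forall>n. \<exists>s r s' r'. (0 < s \<and> s < 1 / Suc n \<and> 0 < r \<and> r < 1 / Suc n) \<and>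
      (0 < s' \<and> s' < 1 / Suc n \<and> 0 < r' \<and> r' < 1 / Suc n) \<and>
      pd j (pd i f) (p + s *\<^sub>R axis i 1 + r *\<^sub>R axis j 1) =
      pd i (pd j f) (p + s' *\<^sub>R axis j 1 + r' *\<^sub>R axis i 1)"
  proof
    fix n
    define h where "h = 1 / real (Suc n)"
    have h: "h > 0" by (simp add: h_def)
    obtain s r where 1: "0 < s" "s < h" "0 < r" "r < h"
      "f (p + h *\<^sub>R axis i 1 + h *\<^sub>R axis j 1) - f (p + h *\<^sub>R axis i 1) - f (p + h *\<^sub>R axis j 1) + f p
        = h * h * pd j (pd i f) (p + s *\<^sub>R axis i 1 + r *\<^sub>R axis j 1)"
      using second_difference_mvt[OF f h, of p i j] by blast
    obtain s' r' where 2: "0 < s'" "s' < h" "0 < r'" "r' < h"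
      "f (p + h *\<^sub>R axis j 1 + h *\<^sub>R axis i 1) - f (p + h *\<^sub>R axis j 1) - f (p + h *\<^sub>R axis i 1) + f p
        = h * h * pd i (pd j f) (p + s' *\<^sub>R axis j 1 + r' *\<^sub>R axis i 1)"
      using second_difference_mvt[OF f h, of p j i] by blast
    have "p + h *\<^sub>R axis j 1 + h *\<^sub>R axis i 1 = p + h *\<^sub>R axis i 1 + h *\<^sub>R axis j 1"
      by (simp add: ac_simps)
    note 1(5) 2(5)[unfolded this]
    then have "h * h * pd j (pd i f) (p + s *\<^sub>R axis i 1 + r *\<^sub>R axis j 1) =
      h * h * pd i (pd j f) (p + s' *\<^sub>R axis j 1 + r' *\<^sub>R axis i 1)"
      by linarith
    with h have "pd j (pd i f) (p + s *\<^sub>R axis i 1 + r *\<^sub>R axis j 1) =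
      pd i (pd j f) (p + s' *\<^sub>R axis j 1 + r' *\<^sub>R axis i 1)"
      by simp
    with 1 2 show "\<exists>s r s' r'. (0 < s \<and> s < 1 / Suc n \<and> 0 < r \<and> r < 1 / Suc n) \<and>
      (0 < s' \<and> s' < 1 / Suc n \<and> 0 < r' \<and> r' < 1 / Suc n) \<and>
      pd j (pd i f) (p + s *\<^sub>R axis i 1 + r *\<^sub>R axis j 1) =
      pd i (pd j f) (p + s' *\<^sub>R axis j 1 + r' *\<^sub>R axis i 1)"
      unfolding h_def[symmetric] by blast
  qed
  then obtain s r s' r' where *:
      "\<And>n. 0 < s n \<and> s n < 1 / Suc n \<and> 0 < r n \<and> r n < 1 / Suc n"
      "\<And>n. 0 < s' n \<and> s' n < 1 / Suc n \<and> 0 < r' n \<and> r' n < 1 / Suc n"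
      "\<And>n. pd j (pd i f) (p + s n *\<^sub>R axis i 1 + r n *\<^sub>R axis j 1) =
      pd i (pd j f) (p + s' n *\<^sub>R axis j 1 + r' n *\<^sub>R axis i 1)"
    by metis
  from lim[OF *(1), of j i] lim[OF *(2), of i j] show "pd i (pd j f) p = pd j (pd i f) p"
    unfolding *(3) by (rule LIMSEQ_unique[symmetric])
qed

section \<open>The cubic connection and its curvature\<close>

lemma Omega_simps [simp]:
  "Omega 1 1 = 0" "Omega 1 2 = 1" "Omega 2 1 = -1" "Omega 2 2 = 0"
  "OmegaU 1 1 = 0" "OmegaU 1 2 = 1" "OmegaU 2 1 = -1" "OmegaU 2 2 = 0"
  by (simp_all add: Omega_def OmegaU_def)

lemma cubic_conn_eq:
  "cubic_conn f i j 1 = (\<lambda>z. pd i f z * pd j f z * pd 2 f z)"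
  "cubic_conn f i j 2 = (\<lambda>z. - (pd i f z * pd j f z * pd 1 f z))"
  by (auto simp: cubic_conn_def conn_of_def ext_d_def sum_2)

lemma cubic_conn_commute: "cubic_conn f i j k = cubic_conn f j i k"
  using exhaust_2[of k] by (auto simp: cubic_conn_eq mult.commute)

lemma smooth_cubic_conn: "smooth f \<Longrightarrow> smooth (cubic_conn f i j k)"
  using exhaust_2[of k] by (auto simp: cubic_conn_eq smooth_rules)

text \<open>Total symmetry of the lowered coefficients is what matters: in the first two indices it
  gives zero torsion, and in the last two it makes the two correction terms in the derivative of
  \<open>Omega\<close> cancel.\<close>

lemma symplectic_connection_cubic_conn:
  assumes "smooth f"
  shows "symplectic_connection (cubic_conn f)"
proof -
  have "cov2 (cubic_conn f) (\<lambda>i j _. Omega i j) a i j p = 0" for a i j p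
    using exhaust_2[of i] exhaust_2[of j] by (auto simp: cov2_def sum_2 cubic_conn_eq)
  then show ?thesis
    using smooth_cubic_conn[OF assms] cubic_conn_commute unfolding symplectic_connection_def by blast
qed

lemma cov_vec_coordinate: "cov_vec \<Gamma> (\<lambda>l _. of_bool (l = p)) = (\<lambda>j k. \<Gamma> j p k)"
  using exhaust_2[of p] by (auto simp: cov_vec_def fun_eq_iff sum_2)

text \<open>Both quadratic terms contain the contraction of \<open>df\<close> with its own raised
  form, which is zero; the terms from the lower index of \<open>cov_mixed\<close> cancel by symmetry
  of the coefficients.\<close>

lemma curv_cubic_conn:
  "curv (cubic_conn f) i j p k z = pd i (cubic_conn f j p k) z - pd j (cubic_conn f i p k) z"
  using cubic_conn_commute[of f i j] exhaust_2[of k]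
  by (auto simp: curv_def Let_def cov_vec_coordinate cov_mixed_def sum_2 cubic_conn_eq algebra_simps)

text \<open>In the trace of the curvature, \<open>cubic_conn f p j p\<close> sums to zero over
  \<open>p\<close>, and the raised \<open>df\<close> is divergence-free because second derivatives
  commute. Only the derivative of \<open>df_i df_j\<close> along the raised \<open>df\<close>
  survives.\<close>

lemma ricci_cubic_conn:
  assumes f: "smooth f"
  shows "ricci (cubic_conn f) i j =
     (\<lambda>z. pd 2 f z * (pd 1 (pd i f) z * pd j f z + pd i f z * pd 1 (pd j f) z)
        - pd 1 f z * (pd 2 (pd i f) z * pd j f z + pd i f z * pd 2 (pd j f) z))"
  using f pd_commute[OF f, of 2 1]
  by (simp add: fun_eq_iff ricci_def sum_2 curv_cubic_conn cubic_conn_eq pd_rules smooth_rules algebra_simps)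

lemma smooth_ricci: "smooth f \<Longrightarrow> smooth (ricci (cubic_conn f) i j)"
  by (simp add: ricci_cubic_conn smooth_rules)

section \<open>The curvature one-form\<close>

lemma U_op_eq:
  assumes f: "smooth f"
  shows "U_op f = (\<lambda>z. pd 1 f z * pd 1 f z * pd 2 (pd 2 f) z - 2 * pd 1 f z * pd 2 f z * pd 1 (pd 2 f) z
    + pd 2 f z * pd 2 f z * pd 1 (pd 1 f) z)"
proof -
  have r: "raise (ext_d f) 1 = pd 2 f" "raise (ext_d f) 2 = (\<lambda>p. - pd 1 f p)"
    by (auto simp: raise_def ext_d_def sum_2)
  show ?thesis
    using f pd_commute[OF f, of 2 1]
    by (simp add: fun_eq_iff U_op_def sum_2 pd_up_def ext_d_def r pd_rules smooth_rules algebra_simps)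
qed

lemma rho_cubic_conn:
  assumes f: "smooth f"
  shows "rho (cubic_conn f) i z = 12 * hess_det f z * ext_d f i z - 2 * ext_d (U_op f) i z"
  \<comment> \<open>Both sides are polynomials in the partial derivatives of \<open>f\<close> up to
    order three. The two instances of \<open>pd_commute\<close> sort mixed derivatives with index 1
    outermost, so the sides can be compared termwise.\<close>
  using exhaust_2[of i] f pd_commute[OF f, of 2 1] pd_commute[OF smooth_pd[OF f], of 2 1]
  by (auto simp: rho_def sum_2 cov2_def hess_det_eq U_op_eq ext_d_def ricci_cubic_conn cubic_conn_eq
     pd_rules smooth_rules algebra_simps)

section \<open>The scalar curvature invariant\<close>

lemma smooth_hess_det: "smooth f \<Longrightarrow> smooth (hess_det f)"
  by (simp add: ext[OF hess_det_eq] smooth_rules)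

lemma smooth_U_op: "smooth f \<Longrightarrow> smooth (U_op f)"
  by (simp add: U_op_eq smooth_rules)

lemma smooth_cov2_ricci:
  assumes "smooth f"
  shows "smooth (cov2 (cubic_conn f) (ricci (cubic_conn f)) a i j)"
  using assms by (simp add: cov2_def[abs_def] sum_2 smooth_rules smooth_ricci smooth_cubic_conn)

text \<open>All connection terms of \<open>cov3\<close> drop out of the contraction: the one acting
  on \<open>i\<close> by symmetry of the lower indices, the other two against each other by total
  symmetry of the lowered coefficients. What is left is half the flat divergence of the raised
  \<open>rho\<close>, a curl in dimension 2.\<close>

lemma double_divergence_ricci:
  assumes f: "smooth f"
  shows "(\<Sum>i\<in>UNIV. \<Sum>j\<in>UNIV. \<Sum>p\<in>UNIV. \<Sum>q\<in>UNIV. OmegaU i p * OmegaU j q *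
      cov3 (cubic_conn f) (cov2 (cubic_conn f) (ricci (cubic_conn f))) p q i j z)
    = (pd 2 (rho (cubic_conn f) 1) z - pd 1 (rho (cubic_conn f) 2) z) / 2"
proof -
  define T where "T = cov2 (cubic_conn f) (ricci (cubic_conn f))"
  have T: "smooth (T a i j)" for a i j
    unfolding T_def by (rule smooth_cov2_ricci[OF f])
  have r: "rho (cubic_conn f) i = (\<lambda>z. 2 * (T 2 i 1 z * (-1) + T 1 i 2 z) * (-1))" for i
    by (simp add: rho_def T_def[symmetric] sum_2 fun_eq_iff)
  show ?thesis
    unfolding r T_def[symmetric]
    by (simp add: sum_2 cov3_def pd_rules smooth_rules T cubic_conn_eq)
qed

text \<open>In dimension \<open>2\<close> the Ricci tensor determines the curvature: \<open>R\<^sub>1\<^sub>2\<^sub>k\<^sub>l = R\<^sub>l\<^sub>k\<close>.\<close>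

lemma curvature_norms_cancel:
  "1/4 * (\<Sum>i\<in>UNIV. \<Sum>j\<in>UNIV. \<Sum>k\<in>UNIV. \<Sum>l\<in>UNIV. curv_up \<Gamma> i j k l z * curv_low \<Gamma> i j k l z)
    = 1/2 * (\<Sum>i\<in>UNIV. \<Sum>j\<in>UNIV. ricci_up \<Gamma> i j z * ricci \<Gamma> i j z)"
proof -
  have "curv \<Gamma> i i k l z = 0" "curv \<Gamma> 2 1 k l z = - curv \<Gamma> 1 2 k l z" for i k l
    by (simp_all add: curv_def Let_def)
  then show ?thesis
    by (simp add: sum_2 curv_up_def curv_low_def ricci_up_def ricci_def algebra_simps)
qed

lemma K_curv_cubic_conn:
  assumes f: "smooth f"
  shows "K_curv (cubic_conn f) z = 6 * poisson f (hess_det f) z"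
proof -
  have "rho (cubic_conn f) i = (\<lambda>z. 12 * hess_det f z * pd i f z - 2 * pd i (U_op f) z)" for i
    using rho_cubic_conn[OF f] by (simp add: fun_eq_iff ext_d_def)
  then have "(pd 2 (rho (cubic_conn f) 1) z - pd 1 (rho (cubic_conn f) 2) z) / 2 = 6 * poisson f (hess_det f) z"
    \<comment> \<open>Commuting derivatives of \<open>U_op f\<close> removes the exact part;
      commuting those of \<open>f\<close> removes the terms in which \<open>hess_det f\<close> is
      not differentiated.\<close>
    using f pd_commute[OF f, of 2 1] pd_commute[OF smooth_U_op[OF f], of 2 1]
    by (simp add: poisson_eq pd_rules smooth_rules smooth_hess_det smooth_U_op field_simps)
  then show ?thesis
    unfolding K_curv_def using double_divergence_ricci[OF f, of z] curvature_norms_cancel[of "cubic_conn f" z]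
    by linarith
qed

section \<open>Projective flatness\<close>

text \<open>\<open>rho\<close> pairs the derivative index with the last Ricci index,
  \<open>cotton\<close> with the first. Symmetry of the Ricci tensor passes to its covariant
  derivative and identifies the two.\<close>

lemma rho_eq_cotton:
  assumes f: "smooth f"
  shows "rho (cubic_conn f) i z = 2 * cotton (cubic_conn f) 1 2 i z"
proof -
  have "ricci (cubic_conn f) i j = ricci (cubic_conn f) j i" for i j
    by (simp add: ricci_cubic_conn[OF f] algebra_simps)
  then have "cov2 (cubic_conn f) (ricci (cubic_conn f)) a 1 2 = cov2 (cubic_conn f) (ricci (cubic_conn f)) a 2 1" for a
    unfolding cov2_def by (simp add: sum_2 algebra_simps)
  then show ?thesis
    using exhaust_2[of i] by (auto simp: rho_def cotton_def sum_2 algebra_simps)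
qed

text \<open>The expression assumed nonzero is \<open>- rho (cubic_conn f) i z / 2\<close>.\<close>

lemma not_projectively_flat_cubic_conn:
  assumes f: "smooth f" and "ext_d (U_op f) i z - 6 * hess_det f z * ext_d f i z \<noteq> 0"
  shows "\<not> projectively_flat (cubic_conn f)"
proof
  assume "projectively_flat (cubic_conn f)"
  then have "rho (cubic_conn f) i z = 0"
    by (simp add: projectively_flat_def rho_eq_cotton[OF f])
  with assms show False by (simp add: rho_cubic_conn)
qed

lemma poisson_const_hess_det:
  assumes f: "smooth f" and "improper_affine_sphere_graph f"
  shows "poisson f (hess_det f) z = 0"
proof -
  obtain c where "hess_det f = (\<lambda>_. c)"
    using assms improper_affine_sphere_graph_iff[OF f] by (auto simp: fun_eq_iff)
  then show ?thesis by (simp add: poisson_eq)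
qed

section \<open>An improper affine sphere that is not projectively flat\<close>

lemma smooth_nth: "smooth (\<lambda>z. z $ k)"
proof -
  have "Ck n (\<lambda>z. z $ k)" for n
    by (cases n) (auto simp: pd_nth[abs_def] Ck_const
        intro!: continuous_intros bounded_linear_imp_differentiable bounded_linear_vec_nth)
  then show ?thesis by (simp add: smooth_def)
qed

text \<open>
  The saddle \<open>f = x y\<close> has \<open>\<M>(f) = -1\<close> and \<open>\<U>(f) = -2 f\<close>, so
  \<open>d\<U>(f) - 6 \<M>(f) df = 4 df\<close>.
\<close>

lemma improper_affine_sphere_not_projectively_flat:
  "\<exists>f. smooth f \<and> improper_affine_sphere_graph f \<and> \<not> projectively_flat (cubic_conn f)"
proof -
  define f :: "real^2 \<Rightarrow> real" where "f = (\<lambda>z. z $ 1 * z $ 2)"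
  have f: "smooth f" unfolding f_def by (intro smooth_mult smooth_nth)
  have pd1: "pd 1 f = (\<lambda>z. z $ 2)" and pd2: "pd 2 f = (\<lambda>z. z $ 1)"
    by (simp_all add: f_def pd_mult smooth_nth pd_nth[abs_def])
  have M: "hess_det f z = -1" for z
    by (simp add: hess_det_eq[OF f] pd1 pd2 pd_nth)
  have "U_op f = (\<lambda>z. - 2 * f z)"
    unfolding U_op_eq[OF f] by (simp add: pd1 pd2 pd_nth) (simp add: f_def ac_simps)
  then have "ext_d (U_op f) 1 z = - 2 * z $ 2" for z
    using f by (simp add: ext_d_def pd_rules smooth_rules pd1)
  \<comment> \<open>The first component of \<open>4 df\<close> is \<open>4 y\<close>, so any point
    with \<open>y\<close> nonzero serves; at \<open>(0, 1)\<close> the value is 4.\<close>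
  then have "ext_d (U_op f) 1 (axis 2 1) - 6 * hess_det f (axis 2 1) * ext_d f 1 (axis 2 1) \<noteq> 0"
    by (simp add: M ext_d_def pd1)
  then have "\<not> projectively_flat (cubic_conn f)"
    by (rule not_projectively_flat_cubic_conn[OF f])
  moreover have "improper_affine_sphere_graph f"
    using M by (auto simp: improper_affine_sphere_graph_iff[OF f])
  ultimately show ?thesis using f by blast
qed

theorem theorem8p3:
  shows "(\<forall>f :: real^2 \<Rightarrow> real. smooth f \<longrightarrow>
      symplectic_connection (cubic_conn f) \<and>
      (\<forall>i z. rho (cubic_conn f) i z = 12 * hess_det f z * ext_d f i z - 2 * ext_d (U_op f) i z) \<and>
      (\<forall>z. K_curv (cubic_conn f) z = 6 * poisson f (hess_det f) z) \<and>
      ((\<forall>z. poisson (hess_det f) f z = 0) \<longrightarrow> (\<forall>z. K_curv (cubic_conn f) z = 0)) \<and>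
      ((\<exists>i z. ext_d (U_op f) i z - 6 * hess_det f z * ext_d f i z \<noteq> 0) \<longrightarrow>
         \<not> projectively_flat (cubic_conn f)) \<and>
      (improper_affine_sphere_graph f \<longrightarrow> (\<forall>z. K_curv (cubic_conn f) z = 0))) \<and>
    (\<exists>f :: real^2 \<Rightarrow> real. smooth f \<and> improper_affine_sphere_graph f \<and>
       \<not> projectively_flat (cubic_conn f))"
proof (intro conjI allI impI)
  fix f :: "real^2 \<Rightarrow> real" and z
  assume f: "smooth f" and "\<forall>z. poisson (hess_det f) f z = 0"
  moreover have "poisson f (hess_det f) z = - poisson (hess_det f) f z"
    by (simp add: poisson_eq)
  ultimately show "K_curv (cubic_conn f) z = 0"
    by (simp add: K_curv_cubic_conn)
qed (use symplectic_connection_cubic_conn rho_cubic_conn K_curv_cubic_conn poisson_const_hess_det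
  not_projectively_flat_cubic_conn improper_affine_sphere_not_projectively_flat in auto)

end
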